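(* Let $n_1,n_2,n_3\ge 1$. For any tensor $\mathcal{T}\in\mathbb{R}^{n_1\times n_2\times n_3}$ there exists a set $\Theta\subseteq\mathbb{B}^{n_1}$ with $|\Theta|\le n_1n_2n_3$ such that $$\|\mathcal{T}\|_*=\max_{\mathcal{Z}\in\mathbb{R}^{n_1\times n_2\times n_3}}\left\{\langle\mathcal{T},\mathcal{Z}\rangle\;:\;\begin{bmatrix}\mathbf{I}_{n_2}&\mathcal{Z}(\mathbf{x})\\ \mathcal{Z}(\mathbf{x})^\top&\mathbf{I}_{n_3}\end{bmatrix}\succeq 0\quad\forall\,\mathbf{x}\in\Theta\right\}.$$
   Context: $\mathbb{B}^{n}=\{\mathbf{x}\in\mathbb{R}^n:\|\mathbf{x}\|=1\}$ is the Euclidean unit sphere. $\langle\cdot,\cdot\rangle$ is the entrywise (Frobenius) inner product of tensors. For $\mathcal{Z}=(\mathbf{Z}_1,\dots,\mathbf{Z}_{n_1})\in\mathbb{R}^{n_1\times n_2\times n_3}$ with slices $\mathbf{Z}_j\in\mathbb{R}^{n_2\times n_3}$ (fixing the first index to $j$) and $\mathbf{x}\in\mathbb{R}^{n_1}$, the contraction is $\mathcal{Z}(\mathbf{x})=\sum_{j=1}^{n_1}x_j\mathbf{Z}_j\in\mathbb{R}^{n_2\times n_3}$. The tensor nuclear norm of $\mathcal{T}\in\mathbb{R}^{n_1\times n_2\times n_3}$ is $$\|\mathcal{T}\|_*=\min\left\{\sum_{r=1}^R|\lambda_r|:\ \mathcal{T}=\sum_{r=1}^R\lambda_r\,\mathbf{x}_1^{(r)}\otimes\mathbf{x}_2^{(r)}\otimes\mathbf{x}_3^{(r)},\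 R\in\mathbb{N},\ \lambda_r\in\mathbb{R},\ \mathbf{x}_\ell^{(r)}\in\mathbb{R}^{n_\ell},\ \|\mathbf{x}_\ell^{(r)}\|=1\ \forall \ell\in\{1,2,3\},\,r\in\{1,\dots,R\}\right\}$$ (the minimum is attained), where $\otimes$ is the vector outer product. *)

theory Defs
  imports "HOL-Analysis.Analysis"
begin

text \<open>
  A tensor of size \<open>n1 \<times> n2 \<times> n3\<close> is an element of \<open>real^'n3^'n2^'n1\<close>: the outermost index is the
  first one, so \<open>Z $ j\<close> is the slice of \<open>Z\<close> with first index \<open>j\<close>, an \<open>n2 \<times> n3\<close> matrix, and the
  library's inner product on this type is the entrywise one (see \<open>inner_tensor\<close> below).
\<close>

type_synonym ('n1, 'n2, 'n3) tensor = "real^'n3^'n2^'n1"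

lemma inner_tensor:
  fixes S T :: "('n1::finite, 'n2::finite, 'n3::finite) tensor"
  shows "S \<bullet> T = (\<Sum>i\<in>UNIV. \<Sum>j\<in>UNIV. \<Sum>k\<in>UNIV. S $ i $ j $ k * T $ i $ j $ k)"
  by (simp add: inner_vec_def)

definition outer_product ::
    "real^'n1 \<Rightarrow> real^'n2 \<Rightarrow> real^'n3 \<Rightarrow> ('n1::finite, 'n2::finite, 'n3::finite) tensor"
  where "outer_product x y z = (\<chi> i j k. x $ i * y $ j * z $ k)"

definition contraction ::
    "('n1::finite, 'n2::finite, 'n3::finite) tensor \<Rightarrow> real^'n1 \<Rightarrow> real^'n3^'n2"
  where "contraction Z x = (\<Sum>j\<in>UNIV. x $ j *\<^sub>R Z $ j)"

definition nuclear_decomposition ::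
    "('n1::finite, 'n2::finite, 'n3::finite) tensor \<Rightarrow> nat \<Rightarrow> (nat \<Rightarrow> real) \<Rightarrow>
     (nat \<Rightarrow> real^'n1) \<Rightarrow> (nat \<Rightarrow> real^'n2) \<Rightarrow> (nat \<Rightarrow> real^'n3) \<Rightarrow> bool"
  where "nuclear_decomposition T R l x y z \<longleftrightarrow>
    (\<forall>r\<in>{1..R}. norm (x r) = 1 \<and> norm (y r) = 1 \<and> norm (z r) = 1) \<and>
    T = (\<Sum>r=1..R. l r *\<^sub>R outer_product (x r) (y r) (z r))"

text \<open>
  The minimum in the following definition is attained, because the unit-norm outer products form
  a compact set that spans the space of tensors; it is the usual infimum.
\<close>

definition nuclear_norm :: "('n1::finite, 'n2::finite, 'n3::finite) tensor \<Rightarrow> real"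
  where "nuclear_norm T =
    (LEAST s. \<exists>R l x y z. nuclear_decomposition T R l x y z \<and> s = (\<Sum>r=1..R. \<bar>l r\<bar>))"

definition block_matrix ::
    "real^'k^'m \<Rightarrow> real^'l^'m \<Rightarrow> real^'k^'n \<Rightarrow> real^'l^'n \<Rightarrow>
     real^('k::finite + 'l::finite)^('m::finite + 'n::finite)"
  where "block_matrix A B C D =
    (\<chi> i j. case i of
       Inl p \<Rightarrow> (case j of Inl q \<Rightarrow> A $ p $ q | Inr q \<Rightarrow> B $ p $ q)
     | Inr p \<Rightarrow> (case j of Inl q \<Rightarrow> C $ p $ q | Inr q \<Rightarrow> D $ p $ q))"

definition positive_semidefinite :: "real^'n^'n::finite \<Rightarrow> bool"
  where "positive_semidefinite A \<longleftrightarrow> transpose A = A \<and> (\<forall>v. 0 \<le> v \<bullet> (A *v v))"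

definition is_maximum :: "'a::order set \<Rightarrow> 'a \<Rightarrow> bool"
  where "is_maximum S m \<longleftrightarrow> m \<in> S \<and> (\<forall>s\<in>S. s \<le> m)"

end

theory Submission
  imports Defs
begin

text \<open>
  The nuclear norm is the gauge of the convex hull of the set \<open>D\<close> of unit outer products. Let \<open>Z\<close>
  maximise \<open>T \<bullet> Z\<close> over the polar of \<open>D\<close>, and let \<open>m\<close> be the maximum. By separation \<open>T / m\<close> lies in the
  convex hull of \<open>D\<close>, hence in the face cut out by the hyperplane \<open>W \<bullet> Z = 1\<close>. That hyperplane has
  dimension \<open>n1 n2 n3 - 1\<close>, so Caratheodory's theorem writes \<open>T / m\<close> as a convex combination of at
  most \<open>n1 n2 n3\<close> atoms; the set \<open>\<Theta>\<close> of their first factors is already enough to force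
  \<open>T \<bullet> Z' \<le> m\<close> for every feasible \<open>Z'\<close>.
\<close>

section \<open>Convex duality for a compact symmetric set of atoms\<close>

text \<open>Strong duality with both certificates: \<open>z\<close> bounds the cost of every
  decomposition of \<open>t\<close> into atoms from below, and \<open>S\<close>, \<open>u\<close>
  give a decomposition attaining that bound. Since \<open>D\<close> contains the basis and its
  negatives, the polar of \<open>D\<close> is bounded, so a maximiser \<open>z\<close>
  exists.\<close>

lemma symmetric_atoms_duality:
  fixes D :: "'a::euclidean_space set"
  assumes D: "compact D" "Basis \<subseteq> D" "\<And>w. w \<in> D \<Longrightarrow> - w \<in> D" and t: "t \<noteq> 0"
  obtains z S u where "\<And>w. w \<in> D \<Longrightarrow> w \<bullet> z \<le> 1" "0 < t \<bullet> z" "finite S" "S \<subseteq> D"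
    "card S \<le> DIM('a)" "\<And>w. w \<in> S \<Longrightarrow> 0 \<le> u w" "sum u S = 1"
    "t = (t \<bullet> z) *\<^sub>R (\<Sum>w\<in>S. u w *\<^sub>R w)"
proof -
  define B where "B = {z. \<forall>w\<in>D. w \<bullet> z \<le> 1}"
  have "B = (\<Inter>w\<in>D. {z. w \<bullet> z \<le> 1})" by (auto simp: B_def)
  then have "closed B" by (simp add: closed_INT closed_halfspace_le)
  moreover have "norm z \<le> DIM('a)" if "z \<in> B" for z
  proof -
    have "\<bar>z \<bullet> b\<bar> \<le> 1" if "b \<in> Basis" for b
    proof -
      have "b \<in> D" "- b \<in> D" using D that by auto
      then have "b \<bullet> z \<le> 1" "(- b) \<bullet> z \<le> 1" using \<open>z \<in> B\<close> unfolding B_def by blast+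
      then show ?thesis by (simp add: inner_commute abs_le_iff)
    qed
    then have "(\<Sum>b\<in>Basis. \<bar>z \<bullet> b\<bar>) \<le> (\<Sum>b\<in>(Basis::'a set). 1)" by (rule sum_mono)
    then show ?thesis using norm_le_l1[of z] by simp
  qed
  then have "bounded B" by (auto simp: bounded_iff)
  ultimately have "compact B" by (simp add: compact_eq_bounded_closed)
  moreover have "0 \<in> B" by (simp add: B_def)
  moreover have "continuous_on B (\<lambda>z. t \<bullet> z)" by (intro continuous_intros)
  ultimately obtain z where z: "z \<in> B" and max: "\<And>y. y \<in> B \<Longrightarrow> t \<bullet> y \<le> t \<bullet> z"
    using continuous_attains_sup[of B "\<lambda>z. t \<bullet> z"] by blast
  define m where "m = t \<bullet> z"
  obtain c where c: "c > 0" "\<And>w. w \<in> D \<Longrightarrow> norm w \<le> c"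
    using compact_imp_bounded[OF D(1)] unfolding bounded_pos by blast
  \<comment> \<open>This point of the polar has value \<open>norm t / c\<close> at \<open>t\<close>,
    which makes the maximum \<open>m\<close> positive.\<close>
  have "(1 / (c * norm t)) *\<^sub>R t \<in> B"
    unfolding B_def
  proof (intro CollectI ballI)
    fix w assume "w \<in> D"
    have "w \<bullet> t \<le> norm w * norm t" by (rule norm_cauchy_schwarz)
    also have "\<dots> \<le> c * norm t" using c \<open>w \<in> D\<close> by (simp add: mult_right_mono)
    finally show "w \<bullet> (1 / (c * norm t)) *\<^sub>R t \<le> 1" using c t by (simp add: field_simps)
  qed
  from max[OF this] have "0 < m"
    using c t unfolding m_def
    by (smt (verit) divide_pos_pos inner_gt_zero_iff inner_scaleR_right mult_pos_pos zero_less_norm_iff)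
  define K where "K = convex hull D"
  have K: "convex K" "compact K" using D by (auto simp: K_def compact_convex_hull)
  have "D \<subseteq> {w. z \<bullet> w \<le> 1}" using z by (auto simp: B_def inner_commute)
  then have "K \<subseteq> {w. z \<bullet> w \<le> 1}"
    unfolding K_def by (rule hull_minimal) (rule convex_halfspace_le)
  then have face: "K \<inter> {w. z \<bullet> w = 1} face_of K"
    using K by (intro face_of_Int_supporting_hyperplane_le) auto
  have "(1/m) *\<^sub>R t \<in> K"
  proof (rule ccontr)
    assume "(1/m) *\<^sub>R t \<notin> K"
    then obtain a b where ab: "a \<bullet> ((1/m) *\<^sub>R t) < b" "\<forall>x\<in>K. b < a \<bullet> x"
      using separating_hyperplane_closed_point[of K] K compact_imp_closed by blast
    have bD: "w \<bullet> (- a) < - b" if "w \<in> D" for w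
      using ab(2) that hull_subset[of D convex] by (auto simp: K_def inner_commute)
    obtain e :: 'a where "e \<in> Basis" using nonempty_Basis by blast
    then have "e \<in> D" "- e \<in> D" using D by auto
    \<comment> \<open>The two bounds at \<open>e\<close> and \<open>- e\<close> add up to
      \<open>0 < - 2 * b\<close>. Dividing by the negative \<open>b\<close> then puts
      \<open>(1/b) *\<^sub>R a\<close> in the polar with a value at \<open>t\<close> above
      \<open>m\<close>, against maximality.\<close>
    then have "b < 0" using bD[of e] bD[of "- e"] by simp
    have "(1/b) *\<^sub>R a \<in> B"
      using bD \<open>b < 0\<close> by (fastforce simp: B_def field_simps)
    from max[OF this] have "(t \<bullet> a) / b \<le> m" by (simp add: m_def)
    moreover have "(a \<bullet> t) / m < b" using ab by simp
    ultimately show False using \<open>0 < m\<close> \<open>b < 0\<close> by (simp add: field_simps inner_commute)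
  qed
  moreover have "z \<bullet> ((1/m) *\<^sub>R t) = 1" using \<open>0 < m\<close> by (simp add: m_def inner_commute)
  ultimately have mem: "(1/m) *\<^sub>R t \<in> K \<inter> {w. z \<bullet> w = 1}" by blast
  \<comment> \<open>The face is spanned by atoms lying in it. Working inside its hyperplane lowers
    Caratheodory's bound from \<open>DIM('a) + 1\<close> to \<open>DIM('a)\<close> atoms.\<close>
  obtain D' where D': "D' \<subseteq> D" "K \<inter> {w. z \<bullet> w = 1} = convex hull D'"
    using face_of_convex_hull_subset[OF D(1)] face unfolding K_def by blast
  have "z \<noteq> 0" using \<open>0 < m\<close> by (auto simp: m_def)
  have "aff_dim D' \<le> aff_dim {w. z \<bullet> w = 1}"
    using D'(2) hull_subset[of D' convex] by (intro aff_dim_subset) blast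
  then have dim: "aff_dim D' \<le> int DIM('a) - 1"
    using \<open>z \<noteq> 0\<close> by (simp add: aff_dim_hyperplane)
  from mem D'(2) have "(1/m) *\<^sub>R t \<in> convex hull D'" by simp
  then obtain S u where S: "finite S" "S \<subseteq> D'" "int (card S) \<le> aff_dim D' + 1"
    "\<forall>w\<in>S. 0 \<le> u w" "sum u S = 1" "(\<Sum>w\<in>S. u w *\<^sub>R w) = (1/m) *\<^sub>R t"
    unfolding convex_hull_caratheodory_aff_dim by blast
  show thesis
  proof (rule that[of z S u])
    show "t = (t \<bullet> z) *\<^sub>R (\<Sum>w\<in>S. u w *\<^sub>R w)" using S \<open>0 < m\<close> by (simp flip: m_def)
  qed (use z S D' dim \<open>0 < m\<close> in \<open>auto simp: B_def m_def\<close>)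
qed

section \<open>Unit outer products as atoms\<close>

text \<open>Links the polar of the atoms to the bilinear forms of the contractions, which the block
  matrices control.\<close>

lemma outer_product_inner:
  "outer_product x y z \<bullet> Z = y \<bullet> (contraction Z x *v z)"
proof -
  have "y \<bullet> (contraction Z x *v z)
      = (\<Sum>j\<in>UNIV. \<Sum>k\<in>UNIV. \<Sum>i\<in>UNIV. x $ i * y $ j * z $ k * Z $ i $ j $ k)"
    by (simp add: inner_vec_def matrix_vector_mult_def contraction_def sum_distrib_left
        sum_distrib_right mult_ac)
  also have "\<dots> = (\<Sum>j\<in>UNIV. \<Sum>i\<in>UNIV. \<Sum>k\<in>UNIV. x $ i * y $ j * z $ k * Z $ i $ j $ k)"
    by (intro sum.cong refl sum.swap)
  also have "\<dots> = outer_product x y z \<bullet> Z"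
    unfolding inner_tensor outer_product_def by (subst sum.swap) simp
  finally show ?thesis by simp
qed

definition unit_outer_products :: "('n1::finite, 'n2::finite, 'n3::finite) tensor set"
  where "unit_outer_products =
    {outer_product x y z | x y z. norm x = 1 \<and> norm y = 1 \<and> norm z = 1}"

lemma compact_unit_outer_products:
  "compact (unit_outer_products :: ('n1::finite, 'n2::finite, 'n3::finite) tensor set)"
proof -
  let ?S = "sphere (0::real^'n1) 1 \<times> sphere (0::real^'n2) 1 \<times> sphere (0::real^'n3) 1"
  have "continuous_on ?S (\<lambda>(x, y, z). outer_product x y z)"
    unfolding outer_product_def case_prod_unfold
    by (intro continuous_on_vec_lambda continuous_intros)
  moreover have "compact ?S" by (intro compact_Times compact_sphere)
  moreover have "unit_outer_products = (\<lambda>(x, y, z). outer_product x y z) ` ?S"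
    by (force simp: unit_outer_products_def image_def)
  ultimately show ?thesis by (metis compact_continuous_image)
qed

lemma uminus_unit_outer_products:
  assumes "w \<in> unit_outer_products"
  shows "- w \<in> unit_outer_products"
proof -
  obtain x y z where w: "w = outer_product x y z" "norm x = 1" "norm y = 1" "norm z = 1"
    using assms by (auto simp: unit_outer_products_def)
  have "- w = outer_product (- x) y z"
    by (simp add: w outer_product_def vec_eq_iff)
  then show ?thesis using w unfolding unit_outer_products_def by force
qed

lemma Basis_subset_unit_outer_products: "Basis \<subseteq> unit_outer_products"
proof
  fix b :: "('n1::finite, 'n2::finite, 'n3::finite) tensor"
  assume "b \<in> Basis"
  then obtain i j k where "b = axis i (axis j (axis k 1))"
    by (auto simp: Basis_vec_def)
  then have "b = outer_product (axis i 1) (axis j 1) (axis k 1)"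
    by (simp add: outer_product_def vec_eq_iff axis_def)
  then show "b \<in> unit_outer_products"
    unfolding unit_outer_products_def by force
qed

section \<open>Semidefinite blocks and the spectral norm\<close>

lemma block_matrix_quadratic_form:
  fixes A :: "real^'n3^'n2::finite"
  shows "v \<bullet> (block_matrix (mat 1) A (transpose A) (mat 1) *v v) =
    (let y = (\<chi> i. v $ Inl i); z = (\<chi> i. v $ Inr i) in (norm y)\<^sup>2 + (norm z)\<^sup>2 + 2 * (y \<bullet> (A *v z)))"
proof -
  define y :: "real^'n2" where "y = (\<chi> i. v $ Inl i)"
  define z :: "real^'n3" where "z = (\<chi> i. v $ Inr i)"
  have sum_split: "sum f UNIV = (\<Sum>i\<in>UNIV. f (Inl i)) + (\<Sum>j\<in>UNIV. f (Inr j))"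
    for f :: "'n2 + 'n3 \<Rightarrow> real"
    by (simp add: UNIV_Plus_UNIV[symmetric] sum.Plus del: UNIV_Plus_UNIV)
  have l: "(block_matrix (mat 1) A (transpose A) (mat 1) *v v) $ Inl i = (mat 1 *v y + A *v z) $ i" for i
    unfolding matrix_vector_mult_def by (simp add: sum_split block_matrix_def y_def z_def)
  have r: "(block_matrix (mat 1) A (transpose A) (mat 1) *v v) $ Inr i
      = (transpose A *v y + mat 1 *v z) $ i" for i
    unfolding matrix_vector_mult_def by (simp add: sum_split block_matrix_def y_def z_def)
  have "v \<bullet> (block_matrix (mat 1) A (transpose A) (mat 1) *v v)
      = y \<bullet> (mat 1 *v y + A *v z) + z \<bullet> (transpose A *v y + mat 1 *v z)"
    unfolding inner_vec_def[of v] sum_split l r by (simp add: inner_vec_def y_def z_def)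
  also have "z \<bullet> (transpose A *v y) = y \<bullet> (A *v z)"
    by (metis dot_lmul_matrix inner_commute transpose_matrix_vector transpose_transpose)
  ultimately show ?thesis
    by (simp add: Let_def inner_add_right power2_norm_eq_inner flip: y_def z_def)
qed

text \<open>Both sides say that the spectral norm of \<open>A\<close> is at most 1; no absolute
  value is needed because \<open>y\<close> may be replaced by \<open>- y\<close>.\<close>

lemma positive_semidefinite_block_iff:
  fixes A :: "real^'n3^'n2::finite"
  shows "positive_semidefinite (block_matrix (mat 1) A (transpose A) (mat 1)) \<longleftrightarrow>
    (\<forall>y z. norm y = 1 \<longrightarrow> norm z = 1 \<longrightarrow> y \<bullet> (A *v z) \<le> 1)"
    (is "?P \<longleftrightarrow> ?Q")
proof
  assume ?P
  show ?Q
  proof (intro allI impI)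
    fix y :: "real^'n2" and z :: "real^'n3"
    assume *: "norm y = 1" "norm z = 1"
    \<comment> \<open>The minus sign turns the quadratic form into
      \<open>2 - 2 * (y \<bullet> (A *v z))\<close>.\<close>
    define v where "v = (\<chi> i. case i of Inl p \<Rightarrow> - y $ p | Inr q \<Rightarrow> z $ q)"
    have "(\<chi> i. v $ Inl i) = - y" "(\<chi> i. v $ Inr i) = z"
      by (simp_all add: v_def vec_eq_iff)
    moreover have "0 \<le> v \<bullet> (block_matrix (mat 1) A (transpose A) (mat 1) *v v)"
      using \<open>?P\<close> unfolding positive_semidefinite_def by blast
    ultimately show "y \<bullet> (A *v z) \<le> 1"
      using * unfolding block_matrix_quadratic_form by (simp add: Let_def)
  qed
next
  assume Q: ?Q
  have "transpose (block_matrix (mat 1) A (transpose A) (mat 1)) = block_matrix (mat 1) A (transpose A) (mat 1)"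
    by (auto simp: transpose_def block_matrix_def vec_eq_iff mat_def split: sum.splits)
  moreover have "0 \<le> v \<bullet> (block_matrix (mat 1) A (transpose A) (mat 1) *v v)" for v
  proof -
    define y where "y = (\<chi> i. v $ Inl i)"
    define z where "z = (\<chi> i. v $ Inr i)"
    \<comment> \<open>By homogeneity this reduces to unit vectors, with the sign moved into
      \<open>y\<close>; the inequality of arithmetic and geometric means then finishes.\<close>
    have "- (y \<bullet> (A *v z)) \<le> norm y * norm z"
    proof (cases "y = 0 \<or> z = 0")
      case False
      then have "(- (1 / norm y) *\<^sub>R y) \<bullet> (A *v ((1 / norm z) *\<^sub>R z)) \<le> 1"
        by (intro Q[rule_format]) auto
      then have "- ((y \<bullet> (A *v z)) / (norm y * norm z)) \<le> 1"
        unfolding matrix_vector_mult_scaleR by (simp add: mult.commute)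
      then show ?thesis using False by (simp add: field_simps)
    qed auto
    moreover have "0 \<le> (norm y - norm z)\<^sup>2" by simp
    ultimately have "0 \<le> (norm y)\<^sup>2 + (norm z)\<^sup>2 + 2 * (y \<bullet> (A *v z))"
      by (simp add: power2_diff)
    then show ?thesis
      unfolding block_matrix_quadratic_form by (simp add: Let_def y_def z_def)
  qed
  ultimately show ?P unfolding positive_semidefinite_def by blast
qed

section \<open>Nuclear norm and conclusion\<close>

text \<open>Weak duality: the atoms are closed under negation, so the one-sided bound on
  \<open>Z\<close> already bounds absolute values.\<close>

lemma nuclear_decomposition_lower_bound:
  assumes "nuclear_decomposition T R l x y z" and Z: "\<And>w. w \<in> unit_outer_products \<Longrightarrow> w \<bullet> Z \<le> 1"
  shows "T \<bullet> Z \<le> (\<Sum>r=1..R. \<bar>l r\<bar>)"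
proof -
  have "T \<bullet> Z = (\<Sum>r=1..R. l r * (outer_product (x r) (y r) (z r) \<bullet> Z))"
    using assms(1) by (simp add: nuclear_decomposition_def inner_sum_left)
  also have "\<dots> \<le> (\<Sum>r=1..R. \<bar>l r\<bar>)"
  proof (rule sum_mono)
    fix r assume "r \<in> {1..R}"
    then have w: "outer_product (x r) (y r) (z r) \<in> unit_outer_products" (is "?w \<in> _")
      using assms(1) unfolding nuclear_decomposition_def unit_outer_products_def by blast
    have "\<bar>?w \<bullet> Z\<bar> \<le> 1"
      using Z[OF w] Z[OF uminus_unit_outer_products[OF w]] by simp
    then have "\<bar>l r\<bar> * \<bar>?w \<bullet> Z\<bar> \<le> \<bar>l r\<bar>" by (simp add: mult_left_le)
    then show "l r * (?w \<bullet> Z) \<le> \<bar>l r\<bar>" by (metis abs_ge_self abs_mult order_trans)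
  qed
  finally show ?thesis .
qed

text \<open>A matching pair of decomposition and dual tensor shows that the \<open>LEAST\<close> is
  attained and gives its value.\<close>

lemma nuclear_norm_eqI:
  assumes "nuclear_decomposition T R l x y z" "(\<Sum>r=1..R. \<bar>l r\<bar>) = T \<bullet> Z"
    and "\<And>w. w \<in> unit_outer_products \<Longrightarrow> w \<bullet> Z \<le> 1"
  shows "nuclear_norm T = T \<bullet> Z"
  unfolding nuclear_norm_def
proof (rule Least_equality)
  show "\<exists>R l x y z. nuclear_decomposition T R l x y z \<and> T \<bullet> Z = (\<Sum>r=1..R. \<bar>l r\<bar>)"
    using assms(1,2) by metis
qed (use nuclear_decomposition_lower_bound assms(3) in blast)

theorem theorem2:
  fixes T :: "('n1::finite, 'n2::finite, 'n3::finite) tensor"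
  shows "\<exists>\<Theta> :: (real^'n1) set.
    \<Theta> \<subseteq> sphere 0 1 \<and> finite \<Theta> \<and> card \<Theta> \<le> CARD('n1) * CARD('n2) * CARD('n3) \<and>
    is_maximum
      {T \<bullet> Z | Z. \<forall>x\<in>\<Theta>. positive_semidefinite
        (block_matrix (mat 1 :: real^'n2^'n2) (contraction Z x)
                      (transpose (contraction Z x)) (mat 1 :: real^'n3^'n3))}
      (nuclear_norm T)"
proof (cases "T = 0")
  case True
  \<comment> \<open>For the zero tensor the empty sum is a decomposition, and the empty
    \<open>\<Theta>\<close> works since every value \<open>T \<bullet> Z\<close> is 0.\<close>
  have "nuclear_decomposition T 0 l x y z" for l x y z
    by (simp add: nuclear_decomposition_def True)
  then have "nuclear_norm T = T \<bullet> 0"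
    by (rule nuclear_norm_eqI) auto
  then show ?thesis
    by (intro exI[of _ "{}"]) (simp add: is_maximum_def True)
next
  case False
  obtain Z S u where Z: "\<And>w. w \<in> unit_outer_products \<Longrightarrow> w \<bullet> Z \<le> 1" "0 < T \<bullet> Z"
    and S: "finite S" "S \<subseteq> unit_outer_products" "card S \<le> DIM(('n1, 'n2, 'n3) tensor)"
    and u: "\<And>w. w \<in> S \<Longrightarrow> 0 \<le> u w" "sum u S = 1"
    and T: "T = (T \<bullet> Z) *\<^sub>R (\<Sum>w\<in>S. u w *\<^sub>R w)"
    by (rule symmetric_atoms_duality[OF compact_unit_outer_products
        Basis_subset_unit_outer_products uminus_unit_outer_products False]) (assumption, rule that)
  define m where "m = T \<bullet> Z"
  have "\<forall>w\<in>S. \<exists>x y z. w = outer_product x y z \<and> norm x = 1 \<and> norm y = 1 \<and> norm z = 1"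
    using S(2) unfolding unit_outer_products_def by blast
  then obtain f1 f2 f3 where f: "\<And>w. w \<in> S \<Longrightarrow> w = outer_product (f1 w) (f2 w) (f3 w) \<and>
      norm (f1 w) = 1 \<and> norm (f2 w) = 1 \<and> norm (f3 w) = 1"
    by metis
  obtain h where h: "bij_betw h {1..card S} S"
    using S(1) ex_bij_betw_nat_finite_1 by blast
  have hS: "h r \<in> S" if "r \<in> {1..card S}" for r
    using h that by (meson bij_betwE)
  have "nuclear_decomposition T (card S) (\<lambda>r. m * u (h r)) (f1 \<circ> h) (f2 \<circ> h) (f3 \<circ> h)"
    unfolding nuclear_decomposition_def
  proof (intro conjI ballI)
    have "T = (\<Sum>w\<in>S. (m * u w) *\<^sub>R w)"
      by (subst T) (simp add: m_def scaleR_sum_right)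
    also have "\<dots> = (\<Sum>r=1..card S. (m * u (h r)) *\<^sub>R h r)"
      by (rule sum.reindex_bij_betw[OF h, symmetric])
    also have "\<dots> = (\<Sum>r=1..card S.
        (m * u (h r)) *\<^sub>R outer_product ((f1 \<circ> h) r) ((f2 \<circ> h) r) ((f3 \<circ> h) r))"
      using f hS by (intro sum.cong) auto
    finally show "T = \<dots>" .
  qed (use f hS in auto)
  moreover have "(\<Sum>r=1..card S. \<bar>m * u (h r)\<bar>) = T \<bullet> Z"
  proof -
    have "(\<Sum>r=1..card S. \<bar>m * u (h r)\<bar>) = (\<Sum>w\<in>S. \<bar>m * u w\<bar>)"
      by (rule sum.reindex_bij_betw[OF h])
    also have "\<dots> = (\<Sum>w\<in>S. m * u w)"
      using u(1) Z(2) by (intro sum.cong) (auto simp: m_def)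
    also have "\<dots> = m" using u(2) by (simp flip: sum_distrib_left)
    finally show ?thesis by (simp add: m_def)
  qed
  ultimately have nn: "nuclear_norm T = m"
    using nuclear_norm_eqI Z(1) unfolding m_def by blast
  have "card (f1 ` S) \<le> CARD('n1) * CARD('n2) * CARD('n3)"
    using S card_image_le[of S f1] by (simp add: mult_ac)
  moreover have "f1 ` S \<subseteq> sphere 0 1" using f by auto
  moreover have "positive_semidefinite (block_matrix (mat 1) (contraction Z x)
      (transpose (contraction Z x)) (mat 1))" if "x \<in> f1 ` S" for x
    unfolding positive_semidefinite_block_iff outer_product_inner[symmetric]
    using that f by (intro allI impI Z(1)) (auto simp: unit_outer_products_def)
  moreover have "T \<bullet> Z' \<le> m"
    if psd: "\<forall>x\<in>f1 ` S. positive_semidefinite (block_matrix (mat 1) (contraction Z' x)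
      (transpose (contraction Z' x)) (mat 1))" for Z'
  proof -
    \<comment> \<open>The constraint at \<open>f1 w\<close> covers all unit pairs, in particular
      \<open>f2 w\<close> and \<open>f3 w\<close>. As \<open>T\<close> is \<open>m\<close> times a
      convex combination of \<open>S\<close>, bounds on \<open>S\<close> alone suffice.\<close>
    have "w \<bullet> Z' \<le> 1" if "w \<in> S" for w
      using psd f[OF that] that outer_product_inner[of "f1 w" "f2 w" "f3 w" Z']
      unfolding positive_semidefinite_block_iff by auto
    then have "(\<Sum>w\<in>S. u w * (w \<bullet> Z')) \<le> (\<Sum>w\<in>S. u w)"
      using u(1) by (intro sum_mono) (simp add: mult_left_le)
    then have "m * (\<Sum>w\<in>S. u w * (w \<bullet> Z')) \<le> m"
      using u(2) Z(2) by (simp add: m_def)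
    moreover have "T \<bullet> Z' = m * (\<Sum>w\<in>S. u w * (w \<bullet> Z'))"
      by (subst T) (simp add: m_def inner_sum_left)
    ultimately show ?thesis by simp
  qed
  ultimately show ?thesis
    using S(1) unfolding is_maximum_def nn
    by (intro exI[of _ "f1 ` S"]) (auto simp: m_def)
qed

end
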